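(* Let $\mathcal{H}$ be a real Hilbert space, let $\lambda>0$, $\mu=\frac{1}{\lambda}$, and let $\Phi:\mathcal{H}\to\mathbb{R}^+\cup\{+\infty\}$ be a closed convex function such that $C=\mathrm{argmin}\,\Phi=\Phi^{-1}(0)\neq\emptyset$. Let $\varepsilon:[0,+\infty[\to[0,+\infty[$ satisfy: (H1) for every $p\in R(N_C)$, $\displaystyle\int_0^{+\infty}\Big(\mu\Phi^*\big(\tfrac{1}{\mu}\varepsilon(t)p\big)-\sigma_C(\varepsilon(t)p)+\tfrac12\|\varepsilon(t)p\|^2\Big)dt<+\infty$; (H2) $\varepsilon(\cdot)$ is nonincreasing, of class $C^1$, Lipschitz continuous on $[0,+\infty[$, $\lim_{t\to+\infty}\varepsilon(t)=0$, $\int_0^{+\infty}\varepsilon(t)dt=+\infty$, and for some $k\ge0$, $-k\varepsilon^2\le\dot\varepsilon$. Let $(x(\cdot),\upsilon(\cdot)):[0,+\infty[\to\mathcal{H}\times\mathcal{H}$ be a strong global solution of $$\upsilon(t)\in\partial\Phi(x(t)),\qquad \lambda\dot x(t)+\dot\upsilon(t)+\upsilon(t)+\varepsilon(t)x(t)=0$$ (with some initial data $x(0)=x_0$, $\upsilon(0)=\upsilon_0\in\partial\Phi(x_0)$), and set $y(t)=x(t)+\mu\upsilon(t)$. Then (i) $y(t)$ converges weakly, as $t\to+\infty$, to $\mathrm{proj}_{\mathrm{argmin}\Phi}0$. If moreover $\Phi(0)<+\infty$, then (ii) $x(t)$ and $y(t)$ both converge weakly, as $t\to+\infty$, to $\mathrm{proj}_{\mathrm{argmin}\Phi}0$;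 (iii) $\upsilon(t)\to0$ strongly, and hence $x(t)-y(t)\to0$ strongly, as $t\to+\infty$.
   Context: $\Phi^*$ is the Fenchel conjugate of $\Phi$; $\sigma_C(x^* )=\sup_{c\in C}\langle x^*,c\rangle$ is the support function of $C$; $N_C(x)=\{x^*:\langle x^*,c-x\rangle\le0\ \forall c\in C\}$ for $x\in C$ (empty otherwise) is the normal cone, and $R(N_C)=\bigcup_{x\in C}N_C(x)$ its range. $\mathrm{proj}_{\mathrm{argmin}\Phi}0$ is the element of minimal norm of the closed convex set $C$. A strong global solution means $x,\upsilon$ absolutely continuous on every bounded interval $[0,b]$, $\upsilon(t)\in\partial\Phi(x(t))$ for all $t\ge0$, and the differential equation holding for almost every $t\ge0$. *)

theory Defs
  imports "HOL-Analysis.Analysis"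
begin

definition convex_fun :: "('a::real_vector \<Rightarrow> ereal) \<Rightarrow> bool" where
  "convex_fun \<Phi> \<longleftrightarrow> (\<forall>x y u. 0 < u \<and> u < 1 \<longrightarrow>
      \<Phi> ((1 - u) *\<^sub>R x + u *\<^sub>R y) \<le> ereal (1 - u) * \<Phi> x + ereal u * \<Phi> y)"

definition closed_fun :: "('a::topological_space \<Rightarrow> ereal) \<Rightarrow> bool" where
  "closed_fun \<Phi> \<longleftrightarrow> (\<forall>c::real. closed {x. \<Phi> x \<le> ereal c})"

definition argmin_set :: "('a \<Rightarrow> ereal) \<Rightarrow> 'a set" where
  "argmin_set \<Phi> = {x. \<forall>z. \<Phi> x \<le> \<Phi> z}"

definition fenchel_conj :: "('a::real_inner \<Rightarrow> ereal) \<Rightarrow> 'a \<Rightarrow> ereal" where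
  "fenchel_conj \<Phi> p = (SUP x. ereal (inner p x) - \<Phi> x)"

definition support_fun :: "'a::real_inner set \<Rightarrow> 'a \<Rightarrow> ereal" where
  "support_fun C p = (SUP c\<in>C. ereal (inner p c))"

definition normal_cone :: "'a::real_inner set \<Rightarrow> 'a \<Rightarrow> 'a set" where
  "normal_cone C x = (if x \<in> C then {p. \<forall>c\<in>C. inner p (c - x) \<le> 0} else {})"

definition normal_cone_range :: "'a::real_inner set \<Rightarrow> 'a set" where
  "normal_cone_range C = (\<Union>x\<in>C. normal_cone C x)"

definition subdiff :: "('a::real_inner \<Rightarrow> ereal) \<Rightarrow> 'a \<Rightarrow> 'a set" where
  "subdiff \<Phi> x = {v. \<Phi> x \<noteq> \<infinity> \<and> (\<forall>z. \<Phi> x + ereal (inner v (z - x)) \<le> \<Phi> z)}"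

definition min_norm_elem :: "'a::real_normed_vector set \<Rightarrow> 'a" where
  "min_norm_elem C = (THE p. p \<in> C \<and> (\<forall>c\<in>C. norm p \<le> norm c))"

definition weakly_tendsto :: "('b \<Rightarrow> 'a::real_inner) \<Rightarrow> 'a \<Rightarrow> 'b filter \<Rightarrow> bool" where
  "weakly_tendsto f l F \<longleftrightarrow> (\<forall>z. ((\<lambda>t. inner (f t) z) \<longlongrightarrow> inner l z) F)"

definition abs_cont_on :: "real \<Rightarrow> real \<Rightarrow> (real \<Rightarrow> 'a::real_normed_vector) \<Rightarrow> bool" where
  "abs_cont_on a b f \<longleftrightarrow> (\<forall>e>0. \<exists>d>0. \<forall>(n::nat) (l::nat \<Rightarrow> real) r.
      (\<forall>i<n. a \<le> l i \<and> l i \<le> r i \<and> r i \<le> b) \<and>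
      (\<forall>i<n. \<forall>j<n. i \<noteq> j \<longrightarrow> r i \<le> l j \<or> r j \<le> l i) \<and>
      (\<Sum>i<n. r i - l i) < d \<longrightarrow> (\<Sum>i<n. norm (f (r i) - f (l i))) < e)"

end

theory Submission
  imports Defs
begin

text \<open>
  Let \<open>p\<close> be the element of minimal norm of \<open>C\<close> and \<open>h = |y - p|\<^sup>2 / 2\<close>. Since
  \<open>y' = - \<mu> (\<upsilon> + \<epsilon> x)\<close> and \<open>\<langle>\<upsilon>, x - p\<rangle> \<ge> \<Phi>(x)\<close>, two applications of Young's inequality give
  \<open>h' + \<mu> c \<epsilon> h \<le> A\<close> almost everywhere, where \<open>c > 0\<close> is a constant and \<open>A\<close> is the integrand of (H1)
  at \<open>- \<mu> p \<in> R(N\<^sub>C)\<close>. As \<open>A\<close> is integrable and \<open>\<epsilon>\<close> is not, \<open>h \<rightarrow> 0\<close>; so \<open>y\<close> converges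
  to \<open>p\<close> even strongly. Finally \<open>\<mu> |\<upsilon>|\<^sup>2 \<le> \<langle>\<upsilon>, y - p\<rangle>\<close> yields \<open>\<upsilon> \<rightarrow> 0\<close>, hence \<open>x \<rightarrow> p\<close>.
  Along the trajectory \<open>A\<close> is nonincreasing, so the differential inequality can be integrated over
  unit intervals with constant bounds, and all that is needed of absolute continuity is that an
  almost everywhere bound on the derivative bounds increments.
\<close>

subsection \<open>Absolutely continuous functions\<close>

text \<open>The index set is an arbitrary finite set, so that the cells of a tagged division can
  serve as indices. Endpoints may touch, but a degenerate interval may not sit in the interior of
  another one.\<close>

definition nonoverlapping :: "real \<Rightarrow> real \<Rightarrow> 'i set \<Rightarrow> ('i \<Rightarrow> real) \<Rightarrow> ('i \<Rightarrow> real) \<Rightarrow> bool" where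
  "nonoverlapping a b I l r \<longleftrightarrow> finite I \<and> (\<forall>i\<in>I. a \<le> l i \<and> l i \<le> r i \<and> r i \<le> b) \<and>
      (\<forall>i\<in>I. \<forall>j\<in>I. i \<noteq> j \<longrightarrow> r i \<le> l j \<or> r j \<le> l i)"

lemma abs_cont_on_iff:
  "abs_cont_on a b f \<longleftrightarrow> (\<forall>e>0. \<exists>d>0. \<forall>n l r. nonoverlapping a b {..<n::nat} l r \<longrightarrow>
      (\<Sum>i<n. r i - l i) < d \<longrightarrow> (\<Sum>i<n. norm (f (r i) - f (l i))) < e)"
  by (simp only: abs_cont_on_def nonoverlapping_def Ball_def lessThan_iff finite_lessThan
      simp_thms imp_conjL)

text \<open>Enumerating \<open>I\<close> by a bijection from an initial segment of the naturals
  carries the condition over to any index type; below it is taken at pairs (tag, cell), at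
  \<open>nat\<close> and at \<open>unit\<close>.\<close>

lemma abs_cont_onE:
  fixes f :: "real \<Rightarrow> 'a::real_normed_vector"
  assumes "abs_cont_on a b f" "e > 0"
  obtains d where "d > 0"
    "\<forall>(I::'i set) l r. nonoverlapping a b I l r \<longrightarrow> (\<Sum>i\<in>I. r i - l i) < d \<longrightarrow>
      (\<Sum>i\<in>I. norm (f (r i) - f (l i))) < e"
proof -
  have "\<exists>d>0. \<forall>n l r. nonoverlapping a b {..<n::nat} l r \<longrightarrow>
      (\<Sum>i<n. r i - l i) < d \<longrightarrow> (\<Sum>i<n. norm (f (r i) - f (l i))) < e"
    using assms(1)[unfolded abs_cont_on_iff, THEN spec, THEN mp, OF assms(2)] .
  then obtain d where "d > 0" and d: "\<forall>n l r. nonoverlapping a b {..<n::nat} l r \<longrightarrow>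
      (\<Sum>i<n. r i - l i) < d \<longrightarrow> (\<Sum>i<n. norm (f (r i) - f (l i))) < e"
    by blast
  have "(\<Sum>i\<in>I. norm (f (r i) - f (l i))) < e"
    if I: "nonoverlapping a b I l r" and small: "(\<Sum>i\<in>I. r i - l i) < d" for I :: "'i set" and l r
  proof -
    have "finite I" using I by (simp add: nonoverlapping_def)
    then obtain g where "bij_betw g {0..<card I} I" using ex_bij_betw_nat_finite by blast
    then have g: "bij_betw g {..<card I} I" by (simp add: atLeast0LessThan)
    have gI: "g i \<in> I" if "i < card I" for i
      using g that by (auto simp: bij_betw_def)
    have ginj: "g i \<noteq> g j" if "i < card I" "j < card I" "i \<noteq> j" for i j
      using g that by (auto simp: bij_betw_def inj_on_def)
    have "nonoverlapping a b {..<card I} (\<lambda>i. l (g i)) (\<lambda>i. r (g i))"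
      using I gI ginj by (simp add: nonoverlapping_def)
    moreover have "(\<Sum>i<card I. r (g i) - l (g i)) < d"
      using small sum.reindex_bij_betw[OF g, of "\<lambda>i. r i - l i"] by simp
    ultimately have "(\<Sum>i<card I. norm (f (r (g i)) - f (l (g i)))) < e"
      using d[rule_format, of "card I" "\<lambda>i. l (g i)" "\<lambda>i. r (g i)"] by simp
    then show ?thesis
      using sum.reindex_bij_betw[OF g, of "\<lambda>i. norm (f (r i) - f (l i))"] by simp
  qed
  then show thesis using that \<open>d > 0\<close> by blast
qed

text \<open>The open intervals are pairwise disjoint, so their lengths add up to the measure of
  their union, which lies in \<open>U\<close>.\<close>

lemma sum_lengths_le_emeasure:
  assumes I: "nonoverlapping a b I l r"
    and sub: "\<And>i. i \<in> I \<Longrightarrow> {l i<..<r i} \<subseteq> U" and U: "U \<in> sets lborel"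
  shows "ennreal (\<Sum>i\<in>I. r i - l i) \<le> emeasure lborel U"
proof -
  have "ennreal (\<Sum>i\<in>I. r i - l i) = (\<Sum>i\<in>I. ennreal (r i - l i))"
    using I by (intro sum_ennreal[symmetric]) (simp add: nonoverlapping_def)
  also have "\<dots> = (\<Sum>i\<in>I. emeasure lborel {l i<..<r i})"
    using I by (intro sum.cong) (simp_all add: nonoverlapping_def)
  also have "\<dots> = emeasure lborel (\<Union>i\<in>I. {l i<..<r i})"
  proof (rule sum_emeasure)
    show "disjoint_family_on (\<lambda>i. {l i<..<r i}) I"
      unfolding disjoint_family_on_def
    proof (intro ballI impI)
      fix i j assume "i \<in> I" "j \<in> I" "i \<noteq> j"
      then have "r i \<le> l j \<or> r j \<le> l i" using I unfolding nonoverlapping_def by blast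
      then show "{l i<..<r i} \<inter> {l j<..<r j} = {}" by auto
    qed
  qed (use I in \<open>auto simp: nonoverlapping_def\<close>)
  also have "\<dots> \<le> emeasure lborel U"
    using sub U by (intro emeasure_mono) auto
  finally show ?thesis .
qed

text \<open>A gauge argument: away from the exceptional null set the derivative controls the increments
  over a fine tagged division, while the intervals tagged in the null set have small total length
  and are handled by absolute continuity.\<close>

lemma abs_cont_on_increment_le:
  fixes f :: "real \<Rightarrow> real"
  assumes ab: "a \<le> b" and ac: "abs_cont_on a b f"
    and der: "AE t in lborel. t \<in> {a..b} \<longrightarrow>
      (\<exists>D\<le>M. (f has_real_derivative D) (at t within {a..b}))"
  shows "f b - f a \<le> M * (b - a)"
proof (rule field_le_epsilon)
  fix e' :: real assume "e' > 0"
  \<comment> \<open>Three errors share \<open>e'\<close>: \<open>e * (b - a)\<close> from the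
    difference quotients, \<open>\<bar>M\<bar> * e\<close> from the length of the cells tagged in
    \<open>N\<close>, and \<open>e\<close> from the increments over those cells.\<close>
  define e where "e = e' / (b - a + 1 + \<bar>M\<bar>)"
  have "b - a + 1 + \<bar>M\<bar> > 0" using ab by simp
  then have "e > 0" and e': "e * (b - a + 1 + \<bar>M\<bar>) = e'"
    using \<open>e' > 0\<close> by (auto simp: e_def)
  obtain d0 where "d0 > 0" and d0: "\<forall>(I::(real \<times> real set) set) l r. nonoverlapping a b I l r \<longrightarrow>
      (\<Sum>i\<in>I. r i - l i) < d0 \<longrightarrow> (\<Sum>i\<in>I. norm (f (r i) - f (l i))) < e"
    using abs_cont_onE[OF ac \<open>e > 0\<close>] by blast
  \<comment> \<open>\<open>d0\<close> serves absolute continuity; \<open>e\<close> bounds the length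
    that the cells tagged in \<open>N\<close> take away from the derivative estimate.\<close>
  define d where "d = min d0 e"
  have "d > 0" using \<open>d0 > 0\<close> \<open>e > 0\<close> by (simp add: d_def)
  obtain N where N: "N \<in> null_sets lborel"
    and dN: "\<And>t. \<lbrakk>t \<in> {a..b}; t \<notin> N\<rbrakk> \<Longrightarrow> \<exists>D\<le>M. (f has_real_derivative D) (at t within {a..b})"
    using der by (elim AE_E3) auto
  obtain U where U: "open U" "N \<subseteq> U" "emeasure lborel (U - N) < d"
    using outer_regular_lborel[of N d] N \<open>d > 0\<close> by (auto simp: null_sets_def)
  have Ud: "emeasure lborel U < d"
    using U(3) N by (subst (asm) emeasure_Diff_null_set) (use U(1) in auto)
  \<comment> \<open>The radius is judged only on intervals \<open>u \<le> t \<le> v\<close> around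
    the tag: there the errors of the linear approximation at \<open>t\<close> on the two sides add
    up to \<open>e * (v - u)\<close>. Tags outside \<open>{a..b}\<close> and \<open>N\<close> only
    need a positive radius.\<close>
  define good where "good t g \<longleftrightarrow> g > 0 \<and> (t \<in> N \<longrightarrow> ball t g \<subseteq> U) \<and>
      (t \<in> {a..b} - N \<longrightarrow> (\<forall>u v. a \<le> u \<and> u \<le> t \<and> t \<le> v \<and> v \<le> b \<and> u \<in> ball t g \<and> v \<in> ball t g \<longrightarrow>
         f v - f u \<le> (M + e) * (v - u)))" for t g
  have "\<exists>g. good t g" for t
  proof (cases "t \<in> N")
    case True
    then obtain g where "g > 0" "ball t g \<subseteq> U"
      using U openE by blast
    then show ?thesis using True by (auto simp: good_def)
  next
    case tN: False
    show ?thesis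
    proof (cases "t \<in> {a..b}")
      case True
      obtain D where "D \<le> M" "(f has_real_derivative D) (at t within {a..b})"
        using dN[OF True tN] by blast
      then obtain g where "g > 0" and
        g: "\<And>u. \<lbrakk>u \<in> {a..b}; \<bar>u - t\<bar> < g\<rbrakk> \<Longrightarrow> \<bar>f u - f t - D * (u - t)\<bar> \<le> e * \<bar>u - t\<bar>"
        unfolding has_field_derivative_def has_derivative_within_alt using \<open>e > 0\<close> by auto
      have "f v - f u \<le> (M + e) * (v - u)"
        if "a \<le> u" "u \<le> t" "t \<le> v" "v \<le> b" "u \<in> ball t g" "v \<in> ball t g" for u v
      proof -
        have "\<bar>f u - f t - D * (u - t)\<bar> \<le> e * (t - u)" "\<bar>f v - f t - D * (v - t)\<bar> \<le> e * (v - t)"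
          using g[of u] g[of v] that by (auto simp: dist_real_def)
        moreover have "D * (v - u) \<le> M * (v - u)"
          using \<open>D \<le> M\<close> that by (intro mult_right_mono) auto
        ultimately show ?thesis by (simp add: algebra_simps abs_le_iff)
      qed
      then show ?thesis using \<open>g > 0\<close> tN unfolding good_def by blast
    next
      case False
      then show ?thesis using tN unfolding good_def by (intro exI[of _ 1]) auto
    qed
  qed
  then obtain g where g: "\<And>t. good t (g t)" by metis
  have g0: "g t > 0" for t using g[of t] by (simp add: good_def)
  have gN: "ball t (g t) \<subseteq> U" if "t \<in> N" for t using g[of t] that by (simp add: good_def)
  have gD: "f v - f u \<le> (M + e) * (v - u)"
    if "t \<in> {a..b} - N" "a \<le> u" "u \<le> t" "t \<le> v" "v \<le> b" "u \<in> ball t (g t)" "v \<in> ball t (g t)"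
    for t u v
    using g[of t] that unfolding good_def by blast
  obtain p where p: "p tagged_division_of {a..b}" and fine: "(\<lambda>t. ball t (g t)) fine p"
    using fine_division_exists_real[OF gauge_ball_dependent] g0 by metis
  note pD = tagged_division_ofD[OF p]
  \<comment> \<open>The additivity of increments over a tagged division, used for
    \<open>total\<close>, is phrased with \<open>Inf K\<close> and \<open>Sup K\<close>.\<close>
  define l r :: "real \<times> real set \<Rightarrow> real" where "l = (\<lambda>(t, K). Inf K)" and "r = (\<lambda>(t, K). Sup K)"
  have K: "snd i = {l i..r i}" "a \<le> l i" "l i \<le> fst i" "fst i \<le> r i" "r i \<le> b"
    "{l i..r i} \<subseteq> ball (fst i) (g (fst i))" if "i \<in> p" for i
  proof -
    obtain t K where i: "i = (t, K)" by (cases i)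
    obtain u v where "K = cbox u v" using pD(4)[of t K] \<open>i \<in> p\<close> unfolding i by blast
    then have uv: "K = {u..v}" by simp
    have "t \<in> K" "K \<subseteq> {a..b}" "K \<subseteq> ball t (g t)"
      using pD(2,3) that i fine by (auto simp: fine_def)
    then show "snd i = {l i..r i}" "a \<le> l i" "l i \<le> fst i" "fst i \<le> r i" "r i \<le> b"
      "{l i..r i} \<subseteq> ball (fst i) (g (fst i))"
      by (auto simp: i l_def r_def uv)
  qed
  \<comment> \<open>Degenerate cells must be removed: their interior is empty, so a tagged division
    may place one inside another cell, which \<open>nonoverlapping\<close> forbids. They contribute
    no increment.\<close>
  define P where "P = {i \<in> p. fst i \<in> N \<and> l i < r i}"
  define Q where "Q = {i \<in> p. fst i \<notin> N}"
  have fin: "finite p" "finite P" "finite Q" using pD(1) by (auto simp: P_def Q_def)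
  have PQ: "P \<inter> Q = {}" "P \<union> Q \<subseteq> p" by (auto simp: P_def Q_def)
  have deg: "r i = l i" if "i \<in> p - (P \<union> Q)" for i
    using K(3,4)[of i] that by (auto simp: P_def Q_def)
  have split: "(\<Sum>i\<in>p. F (r i) - F (l i)) = (\<Sum>i\<in>P. F (r i) - F (l i)) + (\<Sum>i\<in>Q. F (r i) - F (l i))"
    for F :: "real \<Rightarrow> real"
  proof -
    have "(\<Sum>i\<in>p. F (r i) - F (l i)) = (\<Sum>i\<in>P \<union> Q. F (r i) - F (l i))"
      using deg fin PQ by (intro sum.mono_neutral_right) auto
    then show ?thesis using fin PQ by (simp add: sum.union_disjoint)
  qed
  have total: "(\<Sum>i\<in>p. F (r i) - F (l i)) = F b - F a" for F :: "real \<Rightarrow> real"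
    using additive_tagged_division_1[OF ab p, of F] by (simp add: l_def r_def case_prod_unfold)
  have Pdisj: "r i \<le> l j \<or> r j \<le> l i" if "i \<in> P" "j \<in> P" "i \<noteq> j" for i j
  proof -
    have ij: "i \<in> p" "j \<in> p" "l i < r i" "l j < r j" using that by (auto simp: P_def)
    have "interior (snd i) \<inter> interior (snd j) = {}"
      using pD(5)[of "fst i" "snd i" "fst j" "snd j"] ij that(3) by simp
    then have "{l i<..<r i} \<inter> {l j<..<r j} = {}"
      using K(1)[OF ij(1)] K(1)[OF ij(2)] by simp
    \<comment> \<open>If neither cell preceded the other, this midpoint would lie in both open
      intervals.\<close>
    then have "(max (l i) (l j) + min (r i) (r j)) / 2 \<notin> {l i<..<r i} \<inter> {l j<..<r j}"
      by blast
    then show ?thesis using ij(3,4) by (simp add: max_def min_def split: if_splits)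
  qed
  have Pnon: "nonoverlapping a b P l r"
    unfolding nonoverlapping_def
  proof (intro conjI ballI impI)
    show "finite P" by (fact fin)
  next
    fix i assume "i \<in> P"
    then have "i \<in> p" "l i < r i" by (auto simp: P_def)
    then show "a \<le> l i" "l i \<le> r i" "r i \<le> b" using K by auto
  next
    fix i j assume "i \<in> P" "j \<in> P" "i \<noteq> j"
    then show "r i \<le> l j \<or> r j \<le> l i" by (rule Pdisj)
  qed
  have Plen: "(\<Sum>i\<in>P. r i - l i) < d"
  proof -
    have "ennreal (\<Sum>i\<in>P. r i - l i) \<le> emeasure lborel U"
    proof (rule sum_lengths_le_emeasure[OF Pnon])
      show "{l i<..<r i} \<subseteq> U" if "i \<in> P" for i
      proof -
        have "{l i<..<r i} \<subseteq> {l i..r i}" by auto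
        also have "\<dots> \<subseteq> ball (fst i) (g (fst i))" using K(6) that by (auto simp: P_def)
        also have "\<dots> \<subseteq> U" using gN that by (simp add: P_def)
        finally show ?thesis .
      qed
    qed (use U in auto)
    then have "ennreal (\<Sum>i\<in>P. r i - l i) < d" using Ud by (rule le_less_trans)
    moreover have "0 \<le> (\<Sum>i\<in>P. r i - l i)" by (intro sum_nonneg) (auto simp: P_def)
    ultimately show ?thesis by (simp add: ennreal_less_iff)
  qed
  have "(\<Sum>i\<in>P. norm (f (r i) - f (l i))) < e"
    using d0 Pnon Plen by (simp add: d_def)
  moreover have "(\<Sum>i\<in>P. f (r i) - f (l i)) \<le> (\<Sum>i\<in>P. norm (f (r i) - f (l i)))"
    by (intro sum_mono) auto
  ultimately have *: "(\<Sum>i\<in>P. f (r i) - f (l i)) \<le> e" by simp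
  have "(\<Sum>i\<in>Q. f (r i) - f (l i)) \<le> (\<Sum>i\<in>Q. (M + e) * (r i - l i))"
  proof (rule sum_mono)
    fix i assume "i \<in> Q"
    then have i: "i \<in> p" "fst i \<notin> N" by (auto simp: Q_def)
    have "l i \<in> ball (fst i) (g (fst i))" "r i \<in> ball (fst i) (g (fst i))"
      using K[OF i(1)] by (meson atLeastAtMost_iff order.refl order.trans subsetD)+
    then show "f (r i) - f (l i) \<le> (M + e) * (r i - l i)"
      using K[OF i(1)] i(2) by (intro gD[of "fst i"]) auto
  qed
  \<comment> \<open>The lengths over \<open>Q\<close> are the total \<open>b - a\<close> minus those
    over \<open>P\<close>: this is \<open>split\<close> and \<open>total\<close> for the identity
    function.\<close>
  also have "\<dots> = (M + e) * ((b - a) - (\<Sum>i\<in>P. r i - l i))"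
    unfolding sum_distrib_left[symmetric] using split[of "\<lambda>t. t"] total[of "\<lambda>t. t"] by simp
  also have "\<dots> \<le> (M + e) * (b - a) + \<bar>M\<bar> * e"
  proof -
    have s: "0 \<le> (\<Sum>i\<in>P. r i - l i)" by (intro sum_nonneg) (auto simp: P_def)
    have "- M * (\<Sum>i\<in>P. r i - l i) \<le> \<bar>M\<bar> * e"
      using s Plen by (intro mult_mono) (auto simp: d_def)
    moreover have "0 \<le> e * (\<Sum>i\<in>P. r i - l i)" using s \<open>e > 0\<close> by simp
    ultimately show ?thesis by (simp add: algebra_simps)
  qed
  finally show "f b - f a \<le> M * (b - a) + e'"
    using * split[of f] total[of f] e' by (simp add: algebra_simps)
qed

section \<open>Stability of absolute continuity and the derivative of half a squared
  distance\<close>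

lemma abs_cont_on_subset:
  assumes f: "abs_cont_on a b f" and "a \<le> a'" "b' \<le> b"
  shows "abs_cont_on a' b' f"
  unfolding abs_cont_on_iff
proof (intro allI impI)
  fix e :: real assume "e > 0"
  then obtain d where "d > 0" and d: "\<forall>(I::nat set) l r. nonoverlapping a b I l r \<longrightarrow>
      (\<Sum>i\<in>I. r i - l i) < d \<longrightarrow> (\<Sum>i\<in>I. norm (f (r i) - f (l i))) < e"
    using abs_cont_onE[OF f] by blast
  have "nonoverlapping a b I l r" if "nonoverlapping a' b' I l r" for I :: "nat set" and l r
    using that assms(2,3) unfolding nonoverlapping_def by force
  then show "\<exists>d>0. \<forall>n l r. nonoverlapping a' b' {..<n::nat} l r \<longrightarrow>
      (\<Sum>i<n. r i - l i) < d \<longrightarrow> (\<Sum>i<n. norm (f (r i) - f (l i))) < e"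
    using d \<open>d > 0\<close> by blast
qed

lemma abs_cont_on_imp_continuous_on:
  assumes f: "abs_cont_on a b f"
  shows "continuous_on {a..b} f"
proof (clarsimp simp: continuous_on_iff dist_real_def)
  fix t e :: real assume t: "a \<le> t" "t \<le> b" and "e > 0"
  then obtain d where "d > 0" and d: "\<forall>(I::unit set) l r. nonoverlapping a b I l r \<longrightarrow>
      (\<Sum>i\<in>I. r i - l i) < d \<longrightarrow> (\<Sum>i\<in>I. norm (f (r i) - f (l i))) < e"
    using abs_cont_onE[OF f] by blast
  have "dist (f s) (f t) < e" if "a \<le> s" "s \<le> b" "\<bar>s - t\<bar> < d" for s
  proof -
    have "nonoverlapping a b {()} (\<lambda>_. min s t) (\<lambda>_. max s t)"
      using t that by (auto simp: nonoverlapping_def)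
    moreover have "max s t - min s t < d" using that by (auto simp: max_def min_def)
    ultimately have "norm (f (max s t) - f (min s t)) < e"
      using d[rule_format, of "{()}" "\<lambda>_. min s t" "\<lambda>_. max s t"] by simp
    then show ?thesis by (auto simp: dist_norm norm_minus_commute max_def min_def split: if_splits)
  qed
  then show "\<exists>d>0. \<forall>s\<in>{a..b}. \<bar>s - t\<bar> < d \<longrightarrow> dist (f s) (f t) < e"
    using \<open>d > 0\<close> by auto
qed

text \<open>Once both sums are below \<open>e / (2 * (\<bar>K\<bar> + 1))\<close>, the sum for
  \<open>F\<close> is below \<open>e\<close>; the summand 1 keeps the denominator positive for every
  \<open>K\<close>. Two dominating functions are allowed because \<open>y\<close> is controlled by
  \<open>x\<close> and \<open>\<upsilon>\<close> together.\<close>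

lemma abs_cont_on_dominated:
  assumes f: "abs_cont_on a b f" and g: "abs_cont_on a b g"
    and dom: "\<And>s t. \<lbrakk>a \<le> s; s \<le> t; t \<le> b\<rbrakk> \<Longrightarrow>
      norm (F t - F s) \<le> K * (norm (f t - f s) + norm (g t - g s))"
  shows "abs_cont_on a b F"
  unfolding abs_cont_on_iff
proof (intro allI impI)
  fix e :: real assume "e > 0"
  define e' where "e' = e / (2 * (\<bar>K\<bar> + 1))"
  have "e' > 0" and e': "(\<bar>K\<bar> + 1) * (2 * e') = e" using \<open>e > 0\<close> by (auto simp: e'_def field_simps)
  obtain d1 where "d1 > 0" and d1: "\<forall>(I::nat set) l r. nonoverlapping a b I l r \<longrightarrow>
      (\<Sum>i\<in>I. r i - l i) < d1 \<longrightarrow> (\<Sum>i\<in>I. norm (f (r i) - f (l i))) < e'"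
    using abs_cont_onE[OF f \<open>e' > 0\<close>] by blast
  obtain d2 where "d2 > 0" and d2: "\<forall>(I::nat set) l r. nonoverlapping a b I l r \<longrightarrow>
      (\<Sum>i\<in>I. r i - l i) < d2 \<longrightarrow> (\<Sum>i\<in>I. norm (g (r i) - g (l i))) < e'"
    using abs_cont_onE[OF g \<open>e' > 0\<close>] by blast
  have "(\<Sum>i<n. norm (F (r i) - F (l i))) < e"
    if I: "nonoverlapping a b {..<n} l r" and small: "(\<Sum>i<n. r i - l i) < min d1 d2"
    for n :: nat and l r
  proof -
    have "(\<Sum>i<n. norm (F (r i) - F (l i)))
        \<le> (\<Sum>i<n. (\<bar>K\<bar> + 1) * (norm (f (r i) - f (l i)) + norm (g (r i) - g (l i))))"
    proof (rule sum_mono)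
      fix i assume "i \<in> {..<n}"
      then have "norm (F (r i) - F (l i)) \<le> K * (norm (f (r i) - f (l i)) + norm (g (r i) - g (l i)))"
        using I by (intro dom) (auto simp: nonoverlapping_def)
      also have "\<dots> \<le> (\<bar>K\<bar> + 1) * (norm (f (r i) - f (l i)) + norm (g (r i) - g (l i)))"
        by (intro mult_right_mono) auto
      finally show "norm (F (r i) - F (l i)) \<le> \<dots>" .
    qed
    also have "\<dots> = (\<bar>K\<bar> + 1) * ((\<Sum>i<n. norm (f (r i) - f (l i))) + (\<Sum>i<n. norm (g (r i) - g (l i))))"
      by (simp only: sum_distrib_left[symmetric] sum.distrib)
    also have "\<dots> < (\<bar>K\<bar> + 1) * (2 * e')"
    proof (rule mult_strict_left_mono)
      have "(\<Sum>i<n. norm (f (r i) - f (l i))) < e'" "(\<Sum>i<n. norm (g (r i) - g (l i))) < e'"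
        using d1 d2 I small by simp_all
      then show "(\<Sum>i<n. norm (f (r i) - f (l i))) + (\<Sum>i<n. norm (g (r i) - g (l i))) < 2 * e'"
        by simp
    qed simp
    finally show ?thesis using e' by simp
  qed
  then show "\<exists>d>0. \<forall>n l r. nonoverlapping a b {..<n::nat} l r \<longrightarrow>
      (\<Sum>i<n. r i - l i) < d \<longrightarrow> (\<Sum>i<n. norm (F (r i) - F (l i))) < e"
    using \<open>d1 > 0\<close> \<open>d2 > 0\<close> by (intro exI[of _ "min d1 d2"]) simp
qed

text \<open>A continuous \<open>y\<close> is bounded on the compact interval, and half the squared
  norm is Lipschitz on bounded sets.\<close>

lemma abs_cont_on_half_norm_power2:
  fixes y :: "real \<Rightarrow> 'a::real_inner"
  assumes y: "abs_cont_on a b y"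
  shows "abs_cont_on a b (\<lambda>t. (1/2) * (norm (y t - p))\<^sup>2)"
proof -
  have "bounded ((\<lambda>t. y t - p) ` {a..b})"
    using abs_cont_on_imp_continuous_on[OF y]
    by (intro compact_imp_bounded compact_continuous_image continuous_intros) auto
  then obtain B where B: "\<And>t. t \<in> {a..b} \<Longrightarrow> norm (y t - p) \<le> B"
    unfolding bounded_iff by blast
  \<comment> \<open>Here \<open>y\<close> plays both dominating functions, so the Lipschitz constant
    \<open>B\<close> is split into two halves.\<close>
  show ?thesis
  proof (rule abs_cont_on_dominated[OF y y])
    fix s t assume st: "a \<le> s" "s \<le> t" "t \<le> b"
    define u v where "u = norm (y t - p)" and "v = norm (y s - p)"
    have uv: "0 \<le> u" "0 \<le> v" "u \<le> B" "v \<le> B" using B[of s] B[of t] st by (auto simp: u_def v_def)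
    have "\<bar>u - v\<bar> \<le> norm (y t - y s)"
      using norm_triangle_ineq3[of "y t - p" "y s - p"] by (simp add: u_def v_def)
    then have "(1/2) * ((u + v) * \<bar>u - v\<bar>) \<le> (1/2) * ((2 * B) * norm (y t - y s))"
      using uv by (intro mult_left_mono mult_mono) auto
    moreover have "\<bar>(1/2) * u\<^sup>2 - (1/2) * v\<^sup>2\<bar> = (1/2) * ((u + v) * \<bar>u - v\<bar>)"
    proof -
      have "(1/2) * u\<^sup>2 - (1/2) * v\<^sup>2 = (1/2) * ((u + v) * (u - v))"
        by (simp add: power2_eq_square algebra_simps)
      then have "\<bar>(1/2) * u\<^sup>2 - (1/2) * v\<^sup>2\<bar> = \<bar>(1/2) * ((u + v) * (u - v))\<bar>" by (rule arg_cong)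
      also have "\<dots> = (1/2) * ((u + v) * \<bar>u - v\<bar>)" using uv by (simp add: abs_mult)
      finally show ?thesis .
    qed
    ultimately show "norm ((1/2) * (norm (y t - p))\<^sup>2 - (1/2) * (norm (y s - p))\<^sup>2)
        \<le> (B / 2) * (norm (y t - y s) + norm (y t - y s))"
      by (simp add: u_def v_def)
  qed
qed

lemma half_norm_power2_has_real_derivative:
  fixes y :: "real \<Rightarrow> 'a::real_inner"
  assumes "(y has_vector_derivative d) (at t within S)"
  shows "((\<lambda>t. (1/2) * (norm (y t - p))\<^sup>2) has_real_derivative inner d (y t - p)) (at t within S)"
proof -
  have "((\<lambda>t. y t - p) has_derivative (\<lambda>s. s *\<^sub>R d)) (at t within S)"
    using has_derivative_diff[OF assms[unfolded has_vector_derivative_def] has_derivative_const] by simp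
  from has_derivative_mult_right[OF has_derivative_inner[OF this this], of "1/2"]
  show ?thesis
    unfolding has_field_derivative_def power2_norm_eq_inner
    by (rule has_derivative_eq_rhs) (simp add: fun_eq_iff inner_commute)
qed

subsection \<open>Dissipative differential inequalities\<close>

text \<open>The sequence \<open>a\<close> minus the partial sums of \<open>f\<close> decreases and
  is bounded below, so \<open>a\<close> converges. With a limit \<open>l > 0\<close>, the terms
  \<open>e n\<close> would eventually be at most \<open>2 / l\<close> times a telescoping term plus
  \<open>f n\<close>, making \<open>e\<close> summable.\<close>

lemma perturbed_contraction_tendsto_0:
  fixes a e f :: "nat \<Rightarrow> real"
  assumes a: "\<And>n. 0 \<le> a n" and e: "\<And>n. 0 \<le> e n"
    and step: "\<And>n. a (Suc n) * (1 + e n) \<le> a n + f n"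
    and f: "summable f" "\<And>n. 0 \<le> f n" and div: "\<not> summable e"
  shows "a \<longlonglongrightarrow> 0"
proof -
  have mono: "a (Suc n) \<le> a n + f n" for n
    using step[of n] mult_nonneg_nonneg[OF a[of "Suc n"] e[of n]] by (simp add: algebra_simps)
  have "decseq (\<lambda>n. a n - sum f {..<n})"
    using mono by (intro decseq_SucI) (simp add: algebra_simps)
  moreover have "- suminf f \<le> a n - sum f {..<n}" for n
    using sum_le_suminf[OF f(1), of "{..<n}"] a[of n] f(2) by simp
  ultimately obtain L where "(\<lambda>n. a n - sum f {..<n}) \<longlonglongrightarrow> L"
    using decseq_convergent by blast
  then have "(\<lambda>n. a n - sum f {..<n} + sum f {..<n}) \<longlonglongrightarrow> L + suminf f"
    by (intro tendsto_add summable_LIMSEQ f)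
  then obtain l where l: "a \<longlonglongrightarrow> l" by auto
  have "l \<ge> 0" using l a by (auto intro: LIMSEQ_le_const)
  moreover have "\<not> l > 0"
  proof
    assume "l > 0"
    have "eventually (\<lambda>n. a (Suc n) > l / 2) sequentially"
      using LIMSEQ_Suc[OF l] \<open>l > 0\<close> by (intro order_tendstoD) auto
    then have "eventually (\<lambda>n. norm (e n) \<le> (2 / l) * ((a n - a (Suc n)) + f n)) sequentially"
    proof eventually_elim
      case (elim n)
      have "l / 2 * e n \<le> a (Suc n) * e n"
        using elim e by (intro mult_right_mono) auto
      also have "\<dots> \<le> a n - a (Suc n) + f n"
        using step[of n] by (simp add: algebra_simps)
      finally show ?case using \<open>l > 0\<close> e[of n] by (simp add: field_simps)
    qed
    moreover have "summable (\<lambda>n. (2 / l) * ((a n - a (Suc n)) + f n))"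
      by (intro summable_mult summable_add f telescope_summable'[OF l])
    ultimately have "summable e" by (rule summable_comparison_test_ev)
    then show False using div by simp
  qed
  ultimately show ?thesis using l by simp
qed

text \<open>Half of the integral test: on \<open>[n, n+1)\<close> the function is at least its value
  at the right endpoint. Sampling starts at 1 because \<open>A 0\<close> may be infinite even when
  the integral is finite.\<close>

lemma antimono_summable_of_nn_integral:
  fixes A :: "real \<Rightarrow> ennreal"
  assumes anti: "\<And>s t. 0 \<le> s \<Longrightarrow> s \<le> t \<Longrightarrow> A t \<le> A s"
    and fin: "(\<integral>\<^sup>+t\<in>{0..}. A t \<partial>lborel) < \<infinity>"
  shows "A (real (Suc n)) < \<infinity>" and "summable (\<lambda>n. enn2real (A (real (Suc n))))"
proof -
  have bound: "(\<Sum>n<m. A (real (Suc n))) \<le> (\<integral>\<^sup>+t\<in>{0..}. A t \<partial>lborel)" for m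
  proof -
    have "(\<Sum>n<m. A (real (Suc n))) = (\<Sum>n<m. \<integral>\<^sup>+t. A (real (Suc n)) * indicator {real n..<real (Suc n)} t \<partial>lborel)"
      by (simp add: nn_integral_cmult_indicator)
    also have "\<dots> = (\<integral>\<^sup>+t. (\<Sum>n<m. A (real (Suc n)) * indicator {real n..<real (Suc n)} t) \<partial>lborel)"
      by (subst nn_integral_sum) auto
    also have "\<dots> \<le> (\<integral>\<^sup>+t\<in>{0..}. A t \<partial>lborel)"
    proof (rule nn_integral_mono)
      fix t :: real
      show "(\<Sum>n<m. A (real (Suc n)) * indicator {real n..<real (Suc n)} t) \<le> A t * indicator {0..} t"
      proof (cases "t \<ge> 0")
        case True
        \<comment> \<open>At most one indicator is nonzero, the one for the integer part of
          \<open>t\<close>.\<close>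
        have "(\<Sum>n<m. A (real (Suc n)) * indicator {real n..<real (Suc n)} t)
            \<le> (\<Sum>n<m. if n = nat \<lfloor>t\<rfloor> then A t else 0)"
        proof (rule sum_mono)
          fix n
          show "A (real (Suc n)) * indicator {real n..<real (Suc n)} t \<le> (if n = nat \<lfloor>t\<rfloor> then A t else 0)"
          proof (cases "t \<in> {real n..<real (Suc n)}")
            case t: True
            then have "nat \<lfloor>t\<rfloor> = n" by simp linarith
            moreover have "A (real (Suc n)) \<le> A t" using t True by (intro anti) auto
            ultimately show ?thesis using t by (simp del: of_nat_Suc)
          qed simp
        qed
        also have "\<dots> \<le> A t" by (simp add: sum.delta)
        finally show ?thesis using True by simp
      next
        case False
        then have "indicator {real n..<real (Suc n)} t = (0::ennreal)" for n by simp
        then show ?thesis by simp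
      qed
    qed
    finally show ?thesis .
  qed
  show A: "A (real (Suc n)) < \<infinity>" for n
  proof -
    have "A (real (Suc n)) \<le> (\<Sum>k<Suc n. A (real (Suc k)))"
      by (simp add: add_increasing)
    then show ?thesis using bound[of "Suc n"] fin by (metis le_less_trans)
  qed
  show "summable (\<lambda>n. enn2real (A (real (Suc n))))"
  proof (rule bounded_imp_summable)
    fix m
    have "ennreal (\<Sum>n\<le>m. enn2real (A (real (Suc n)))) = (\<Sum>n\<le>m. A (real (Suc n)))"
      using A by (simp add: sum_ennreal[symmetric] less_top)
    also have "\<dots> \<le> ennreal (enn2real (\<integral>\<^sup>+t\<in>{0..}. A t \<partial>lborel))"
      using bound[of "Suc m"] fin by (simp add: lessThan_Suc_atMost less_top)
    finally show "(\<Sum>n\<le>m. enn2real (A (real (Suc n)))) \<le> enn2real (\<integral>\<^sup>+t\<in>{0..}. A t \<partial>lborel)"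
      by simp
  qed simp
qed

text \<open>The other half of the integral test: the value at the left endpoint dominates
  \<open>g\<close> on \<open>[n, n+1)\<close>, so a convergent series would make the integral
  finite.\<close>

lemma antimono_not_summable_of_nn_integral:
  fixes g :: "real \<Rightarrow> real"
  assumes anti: "\<And>s t. 0 \<le> s \<Longrightarrow> s \<le> t \<Longrightarrow> g t \<le> g s" and nonneg: "\<And>t. 0 \<le> t \<Longrightarrow> 0 \<le> g t"
    and inf: "(\<integral>\<^sup>+t\<in>{0..}. ennreal (g t) \<partial>lborel) = \<infinity>"
  shows "\<not> summable (\<lambda>n. g (real n))"
proof
  assume s: "summable (\<lambda>n. g (real n))"
  have "(\<integral>\<^sup>+t\<in>{0..}. ennreal (g t) \<partial>lborel)
      \<le> (\<integral>\<^sup>+t. (\<Sum>n. ennreal (g (real n)) * indicator {real n..<real (Suc n)} t) \<partial>lborel)"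
  proof (rule nn_integral_mono)
    fix t :: real
    show "ennreal (g t) * indicator {0..} t
        \<le> (\<Sum>n. ennreal (g (real n)) * indicator {real n..<real (Suc n)} t)"
    proof (cases "t \<ge> 0")
      case True
      define n where "n = nat \<lfloor>t\<rfloor>"
      have n: "real n \<le> t" "t < real (Suc n)" using True by (auto simp: n_def) linarith
      have "ennreal (g t) * indicator {0..} t \<le> ennreal (g (real n)) * indicator {real n..<real (Suc n)} t"
        using n True anti[of "real n" t] by (simp add: ennreal_leI)
      also have "\<dots> = (\<Sum>k\<in>{n}. ennreal (g (real k)) * indicator {real k..<real (Suc k)} t)"
        by (subst sum.insert) auto
      also have "\<dots> \<le> (\<Sum>k. ennreal (g (real k)) * indicator {real k..<real (Suc k)} t)"
        by (intro sum_le_suminf) auto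
      finally show ?thesis .
    qed simp
  qed
  also have "\<dots> = (\<Sum>n. ennreal (g (real n)))"
    by (subst nn_integral_suminf) (auto simp: nn_integral_cmult_indicator)
  also have "\<dots> < \<infinity>"
    using s nonneg by (simp add: suminf_ennreal2)
  finally show False using inf by simp
qed

text \<open>At the positive integers \<open>h\<close> obeys a perturbed contraction with summable
  perturbation and divergent rates, hence tends to 0 there. Between consecutive integers it rises by
  at most a term of a summable sequence.\<close>

lemma dissipation_tendsto_0:
  fixes h g :: "real \<Rightarrow> real" and A :: "real \<Rightarrow> ennreal"
  assumes h: "\<And>t. 0 \<le> t \<Longrightarrow> 0 \<le> h t" and ac: "\<And>b. 0 \<le> b \<Longrightarrow> abs_cont_on 0 b h"
    and der: "AE t in lborel. 0 \<le> t \<longrightarrow>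
      (\<exists>D. (h has_real_derivative D) (at t within {0..}) \<and> ennreal (D + g t * h t) \<le> A t)"
    and A_anti: "\<And>s t. 0 \<le> s \<Longrightarrow> s \<le> t \<Longrightarrow> A t \<le> A s"
    and A_int: "(\<integral>\<^sup>+t\<in>{0..}. A t \<partial>lborel) < \<infinity>"
    and g_nonneg: "\<And>t. 0 \<le> t \<Longrightarrow> 0 \<le> g t" and g_anti: "\<And>s t. 0 \<le> s \<Longrightarrow> s \<le> t \<Longrightarrow> g t \<le> g s"
    and g_div: "\<not> summable (\<lambda>n. g (real n))"
  shows "(h \<longlongrightarrow> 0) at_top"
proof -
  \<comment> \<open>By monotonicity, \<open>\<alpha> n\<close> majorizes \<open>A\<close> on all of
    \<open>[n+1, \<infinity>)\<close>; it is used on the unit interval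
    \<open>[n+1, n+2]\<close>.\<close>
  define \<alpha> where "\<alpha> n = enn2real (A (real (Suc n)))" for n
  have \<alpha>0: "0 \<le> \<alpha> n" for n by (simp add: \<alpha>_def)
  have A_fin: "A (real (Suc n)) = ennreal (\<alpha> n)" for n
    using antimono_summable_of_nn_integral(1)[of A n] A_anti A_int by (simp add: \<alpha>_def less_top)
  have \<alpha>_sum: "summable \<alpha>"
    unfolding \<alpha>_def by (rule antimono_summable_of_nn_integral(2)[OF A_anti A_int])
  have incr: "h v - h u \<le> M * (v - u)"
    if uv: "real (Suc n) \<le> u" "u \<le> v" and M: "\<And>t. u \<le> t \<Longrightarrow> t \<le> v \<Longrightarrow> \<alpha> n - g t * h t \<le> M" for n u v M
  proof (rule abs_cont_on_increment_le[OF uv(2)])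
    have "0 \<le> v" using uv by linarith
    then show "abs_cont_on u v h"
      using uv by (intro abs_cont_on_subset[OF ac[OF \<open>0 \<le> v\<close>]]) auto
    show "AE t in lborel. t \<in> {u..v} \<longrightarrow> (\<exists>D\<le>M. (h has_real_derivative D) (at t within {u..v}))"
      using der
    proof eventually_elim
      case (elim t)
      show ?case
      proof
        assume t: "t \<in> {u..v}"
        then have "0 \<le> t" using uv by simp
        then obtain D where D: "(h has_real_derivative D) (at t within {0..})"
          and "ennreal (D + g t * h t) \<le> A t" using elim by blast
        moreover have "A t \<le> A (real (Suc n))" using t uv by (intro A_anti) auto
        ultimately have "ennreal (D + g t * h t) \<le> ennreal (\<alpha> n)"
          using A_fin order.trans by metis
        then have "D + g t * h t \<le> \<alpha> n" using \<alpha>0 by (simp add: ennreal_le_iff)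
        then have "D \<le> M" using M[of t] t by simp
        moreover have "(h has_real_derivative D) (at t within {u..v})"
          using uv by (intro DERIV_subset[OF D]) auto
        ultimately show "\<exists>D\<le>M. (h has_real_derivative D) (at t within {u..v})" by blast
      qed
    qed
  qed
  \<comment> \<open>Here the dissipation \<open>g t * h t\<close> is simply discarded as
    nonnegative.\<close>
  have short: "h v - h u \<le> \<alpha> n"
    if uv: "real (Suc n) \<le> u" "u \<le> v" "v \<le> real (Suc n) + 1" for n u v
  proof -
    have "h v - h u \<le> \<alpha> n * (v - u)"
    proof (rule incr[OF uv(1,2)])
      fix t assume "u \<le> t"
      then have "0 \<le> t" using uv(1) by simp
      then show "\<alpha> n - g t * h t \<le> \<alpha> n" using h[of t] g_nonneg[of t] by simp
    qed
    also have "\<dots> \<le> \<alpha> n" using uv \<alpha>0 by (intro mult_left_le) auto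
    finally show ?thesis .
  qed
  have step: "h (real (Suc (Suc n))) * (1 + g (real (Suc (Suc n)))) \<le> h (real (Suc n)) + \<alpha> n * (1 + g 0)"
    for n
  proof -
    define u v where "u = real (Suc n)" and "v = real (Suc (Suc n))"
    have uv: "u \<le> v" "v = u + 1" "0 \<le> u" by (auto simp: u_def v_def)
    \<comment> \<open>A constant lower bound for the dissipation on \<open>[u, v]\<close>: by
      \<open>short\<close>, \<open>h\<close> cannot have been below \<open>h v - \<alpha> n\<close>,
      and \<open>g\<close> is smallest at \<open>v\<close>. The implicit form in \<open>h v\<close>
      is what yields the factor \<open>1 + g v\<close>.\<close>
    have "h v - h u \<le> (\<alpha> n - g v * (h v - \<alpha> n)) * (v - u)"
    proof (rule incr[of n])
      fix t assume t: "u \<le> t" "t \<le> v"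
      have "h v - h t \<le> \<alpha> n" using short[of n t v] t uv by (simp add: u_def)
      then have "g v * (h v - \<alpha> n) \<le> g v * h t"
        using g_nonneg[of v] uv by (intro mult_left_mono) auto
      also have "\<dots> \<le> g t * h t"
        using t uv by (intro mult_right_mono g_anti h) auto
      finally show "\<alpha> n - g t * h t \<le> \<alpha> n - g v * (h v - \<alpha> n)" by simp
    qed (use uv in \<open>auto simp: u_def\<close>)
    then have "h v * (1 + g v) \<le> h u + \<alpha> n * (1 + g v)"
      using uv by (simp add: algebra_simps)
    also have "\<dots> \<le> h u + \<alpha> n * (1 + g 0)"
      using \<alpha>0[of n] g_anti[of 0 v] uv by (intro add_left_mono mult_left_mono) auto
    finally show ?thesis by (simp add: u_def v_def)
  qed
  have "(\<lambda>n. h (real (Suc n))) \<longlonglongrightarrow> 0"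
  proof (rule perturbed_contraction_tendsto_0)
    show "h (real (Suc (Suc n))) * (1 + g (real (Suc (Suc n)))) \<le> h (real (Suc n)) + \<alpha> n * (1 + g 0)"
      for n by (rule step)
    show "\<not> summable (\<lambda>n. g (real (Suc (Suc n))))"
      using g_div summable_iff_shift[of "\<lambda>n. g (real n)" 2] by simp
    show "summable (\<lambda>n. \<alpha> n * (1 + g 0))" by (intro summable_mult2 \<alpha>_sum)
  qed (use h g_nonneg \<alpha>0 in auto)
  then have lim: "(\<lambda>n. h (real (Suc n)) + \<alpha> n) \<longlonglongrightarrow> 0"
    using tendsto_add[OF _ summable_LIMSEQ_zero[OF \<alpha>_sum]] by force
  show ?thesis
  proof (rule tendstoI)
    fix e :: real assume "e > 0"
    then have "eventually (\<lambda>n. h (real (Suc n)) + \<alpha> n < e) sequentially"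
      using lim by (intro order_tendstoD)
    then obtain N where N: "\<And>n. n \<ge> N \<Longrightarrow> h (real (Suc n)) + \<alpha> n < e"
      unfolding eventually_sequentially by blast
    have "dist (h t) 0 < e" if "t \<ge> real (Suc N)" for t
    proof -
      \<comment> \<open>The shift makes \<open>real (Suc n)\<close> the integer part of
        \<open>t\<close>; since \<open>t \<ge> 1\<close>, the natural subtraction does not
        truncate.\<close>
      define n where "n = nat \<lfloor>t\<rfloor> - 1"
      have "1 \<le> \<lfloor>t\<rfloor>" "int N \<le> \<lfloor>t\<rfloor> - 1" using that by linarith+
      then have "real (Suc n) = of_int \<lfloor>t\<rfloor>" "N \<le> n" by (auto simp: n_def)
      then have n: "real (Suc n) \<le> t" "t \<le> real (Suc n) + 1" by linarith+
      have "h t \<le> h (real (Suc n)) + \<alpha> n" using short[of n "real (Suc n)" t] n by simp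
      moreover have "0 \<le> h t" using h[of t] that by simp
      ultimately show ?thesis using N[OF \<open>N \<le> n\<close>] by (simp add: dist_real_def)
    qed
    then show "eventually (\<lambda>t. dist (h t) 0 < e) at_top"
      unfolding eventually_at_top_linorder by blast
  qed
qed

subsection \<open>Convex analysis\<close>

text \<open>A minimizing sequence is Cauchy by the parallelogram law, and the same estimate gives
  uniqueness. This makes the definite description in \<open>min_norm_elem\<close>
  meaningful.\<close>

lemma ex1_min_norm:
  fixes C :: "'a::{real_inner,complete_space} set"
  assumes "closed C" "convex C" "C \<noteq> {}"
  shows "\<exists>!p. p \<in> C \<and> (\<forall>c\<in>C. norm p \<le> norm c)"
proof -
  define m where "m = (INF c\<in>C. (norm c)\<^sup>2)"
  have bdd: "bdd_below ((\<lambda>c. (norm c)\<^sup>2) ` C)" by (rule bdd_belowI[of _ 0]) auto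
  have m: "m \<le> (norm c)\<^sup>2" if "c \<in> C" for c
    unfolding m_def using bdd that by (rule cINF_lower)
  \<comment> \<open>Parallelogram law, with the midpoint of \<open>c\<close> and \<open>c'\<close>
    again in \<open>C\<close> and so of squared norm at least \<open>m\<close>.\<close>
  have par: "(norm (c - c'))\<^sup>2 \<le> 2 * ((norm c)\<^sup>2 - m) + 2 * ((norm c')\<^sup>2 - m)"
    if "c \<in> C" "c' \<in> C" for c c'
  proof -
    have "(1/2) *\<^sub>R c + (1/2) *\<^sub>R c' \<in> C"
      using assms(2) that by (intro convexD) auto
    then have "m \<le> (norm ((1/2) *\<^sub>R c + (1/2) *\<^sub>R c'))\<^sup>2" by (rule m)
    then show ?thesis
      by (simp add: power2_norm_eq_inner algebra_simps inner_commute)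
  qed
  have "\<exists>c\<in>C. (norm c)\<^sup>2 < m + 1 / real (Suc n)" for n
    using cINF_less_iff[OF assms(3) bdd, of "m + 1 / real (Suc n)"] by (simp add: m_def)
  then obtain c where c: "\<And>n. c n \<in> C" "\<And>n. (norm (c n))\<^sup>2 < m + 1 / real (Suc n)"
    by metis
  have "Cauchy c"
  proof (rule metric_CauchyI)
    fix e :: real assume "e > 0"
    \<comment> \<open>Beyond \<open>M\<close> each squared norm exceeds \<open>m\<close> by less
      than a quarter of the square of \<open>e\<close>, which is what \<open>par\<close>
      needs.\<close>
    obtain M where M: "4 / e\<^sup>2 < real M" using reals_Archimedean2 by blast
    have "dist (c i) (c j) < e" if "i \<ge> M" "j \<ge> M" for i j
    proof -
      have le: "1 / real (Suc k) < e\<^sup>2 / 4" if "k \<ge> M" for k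
      proof -
        have "4 / e\<^sup>2 < real (Suc k)" using M that by linarith
        then show ?thesis using \<open>e > 0\<close> by (simp add: field_simps)
      qed
      have "(norm (c i - c j))\<^sup>2 < e\<^sup>2"
        using par[OF c(1) c(1), of i j] c(2)[of i] c(2)[of j] le[OF that(1)] le[OF that(2)] by argo
      then show ?thesis using \<open>e > 0\<close> by (auto simp: dist_norm intro: power2_less_imp_less)
    qed
    then show "\<exists>M. \<forall>i\<ge>M. \<forall>j\<ge>M. dist (c i) (c j) < e" by blast
  qed
  then obtain p where p: "c \<longlonglongrightarrow> p" using Cauchy_convergent convergent_def by blast
  have pC: "p \<in> C" using closed_sequentially[OF assms(1)] c(1) p by blast
  have "(\<lambda>n. m + 1 / real (Suc n)) \<longlonglongrightarrow> m + 0"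
    by (intro tendsto_intros LIMSEQ_Suc[OF lim_1_over_n])
  moreover have "(\<lambda>n. (norm (c n))\<^sup>2) \<longlonglongrightarrow> (norm p)\<^sup>2"
    using p by (intro tendsto_intros)
  ultimately have "(norm p)\<^sup>2 \<le> m + 0"
    using c(2) by (intro LIMSEQ_le) (auto intro: less_imp_le)
  then have pm: "(norm p)\<^sup>2 \<le> (norm d)\<^sup>2" if "d \<in> C" for d using m[OF that] by linarith
  have "q = p" if "q \<in> C" "\<forall>d\<in>C. norm q \<le> norm d" for q
  proof -
    have "(norm q)\<^sup>2 \<le> (norm p)\<^sup>2" using that pC by (intro power_mono) auto
    then have "(norm (q - p))\<^sup>2 \<le> 0"
      using par[OF that(1) pC] \<open>(norm p)\<^sup>2 \<le> m + 0\<close> by argo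
    then show ?thesis by simp
  qed
  then show ?thesis using pC power2_le_imp_le[OF pm norm_ge_zero] by blast
qed

text \<open>To be read with \<open>w = x - p\<close>, \<open>v = \<upsilon>\<close> and
  \<open>\<phi> = \<Phi> x\<close>: then \<open>w + \<mu> *\<^sub>R v = y - p\<close>, and the
  right-hand side is \<open>- 1 / \<mu>\<close> times the derivative of half the squared distance
  from \<open>y\<close> to \<open>p\<close>. One half of \<open>\<mu>\<close> times the squared norm
  of \<open>v\<close> absorbs the decay term, the other half the cross term of \<open>p\<close> and
  \<open>v\<close>.\<close>

lemma lyapunov_rate:
  fixes w p v :: "'a::real_inner"
  assumes "0 < \<mu>" "0 \<le> e" "0 \<le> c" "c \<le> 1" "2 * c * e * \<mu> \<le> 1"
    and "0 \<le> \<phi>" "\<phi> \<le> inner v w"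
  shows "c * e * ((1/2) * (norm (w + \<mu> *\<^sub>R v))\<^sup>2) + \<phi> + e * inner p w - (1/2) * \<mu> * e\<^sup>2 * (norm p)\<^sup>2
      \<le> inner v (w + \<mu> *\<^sub>R v) + e * inner (w + p) (w + \<mu> *\<^sub>R v)"
proof -
  define A B W P Q R where "A = inner v v" and "B = inner v w" and "W = inner w w"
    and "P = inner p p" and "Q = inner p w" and "R = inner p v"
  note defs = A_def B_def W_def P_def Q_def R_def
  have pos: "0 \<le> A" "0 \<le> W" by (simp_all add: defs)
  have y: "(norm (w + \<mu> *\<^sub>R v))\<^sup>2 = W + 2 * \<mu> * B + \<mu>\<^sup>2 * A"
    unfolding power2_norm_eq_inner
    by (simp add: defs algebra_simps inner_commute power2_eq_square)
  have "0 \<le> (norm (w - \<mu> *\<^sub>R v))\<^sup>2" by simp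
  also have "\<dots> = W - 2 * \<mu> * B + \<mu>\<^sup>2 * A"
    unfolding power2_norm_eq_inner
    by (simp add: defs algebra_simps inner_commute power2_eq_square)
  finally have "(1/2) * (norm (w + \<mu> *\<^sub>R v))\<^sup>2 \<le> W + \<mu>\<^sup>2 * A" using y by argo
  then have "c * e * ((1/2) * (norm (w + \<mu> *\<^sub>R v))\<^sup>2) \<le> c * e * (W + \<mu>\<^sup>2 * A)"
    using assms by (intro mult_left_mono) auto
  also have "\<dots> = c * (e * W) + (2 * c * e * \<mu>) * ((1/2) * \<mu> * A)"
    by (simp add: algebra_simps power2_eq_square)
  \<comment> \<open>The conditions \<open>c \<le> 1\<close> and
    \<open>2 * c * e * \<mu> \<le> 1\<close> are tailored to these two terms.\<close>
  also have "\<dots> \<le> 1 * (e * W) + 1 * ((1/2) * \<mu> * A)"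
    using assms pos by (intro add_mono mult_right_mono) auto
  finally have 1: "c * e * ((1/2) * (norm (w + \<mu> *\<^sub>R v))\<^sup>2) \<le> e * W + (1/2) * \<mu> * A" by simp
  \<comment> \<open>Second use of Young's inequality, for the cross term
    \<open>\<mu> * e * R\<close>; its price is the quadratic term of the (H1) integrand.\<close>
  have "0 \<le> (1/2) * \<mu> * (norm (e *\<^sub>R p + v))\<^sup>2" using assms by simp
  also have "\<dots> = (1/2) * \<mu> * e\<^sup>2 * P + \<mu> * e * R + (1/2) * \<mu> * A"
    unfolding power2_norm_eq_inner
    by (simp add: defs algebra_simps inner_commute power2_eq_square)
  finally have 2: "0 \<le> (1/2) * \<mu> * e\<^sup>2 * P + \<mu> * e * R + (1/2) * \<mu> * A" .
  have 3: "\<phi> \<le> B" "0 \<le> \<mu> * e * B" using assms by (auto simp: B_def)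
  have "inner v (w + \<mu> *\<^sub>R v) + e * inner (w + p) (w + \<mu> *\<^sub>R v)
      = B + \<mu> * A + e * W + \<mu> * e * B + e * Q + \<mu> * e * R"
    by (simp add: defs algebra_simps inner_commute)
  moreover have "(norm p)\<^sup>2 = P" by (simp add: power2_norm_eq_inner P_def)
  ultimately show ?thesis using 1 2 3 by (simp add: Q_def)
qed

text \<open>The value \<open>s\<close> of \<open>\<epsilon>\<close> is the variable here, so that
  monotonicity in \<open>s\<close> turns into monotonicity in time because \<open>\<epsilon>\<close>
  is nonincreasing.\<close>

definition H1_integrand :: "('a::real_inner \<Rightarrow> ereal) \<Rightarrow> real \<Rightarrow> 'a \<Rightarrow> real \<Rightarrow> ereal" where
  "H1_integrand \<Phi> \<mu> p s = ereal \<mu> * fenchel_conj \<Phi> ((s / \<mu>) *\<^sub>R p)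
      - support_fun (\<Phi> -` {0}) (s *\<^sub>R p) + ereal ((1/2) * (norm (s *\<^sub>R p))\<^sup>2)"

section \<open>Bounds for the (H1) integrand along a ray of normal directions\<close>

context
  fixes \<Phi> :: "'a::real_inner \<Rightarrow> ereal" and p q :: 'a
  assumes nonneg: "\<And>z. 0 \<le> \<Phi> z" and p: "\<Phi> p = 0"
    and q: "\<And>c. \<Phi> c = 0 \<Longrightarrow> inner q (c - p) \<le> 0"
begin

text \<open>Since \<open>q\<close> is normal to the zero set at \<open>p\<close>, the supremum is
  attained at \<open>p\<close>.\<close>

lemma support_fun_zero_set:
  assumes "0 \<le> s"
  shows "support_fun (\<Phi> -` {0}) (s *\<^sub>R q) = ereal (s * inner q p)"
  unfolding support_fun_def
proof (rule antisym)
  show "(SUP c\<in>\<Phi> -` {0}. ereal (inner (s *\<^sub>R q) c)) \<le> ereal (s * inner q p)"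
  proof (rule SUP_least)
    fix c assume "c \<in> \<Phi> -` {0}"
    then have "inner q c \<le> inner q p" using q[of c] by (simp add: inner_diff_right)
    then show "ereal (inner (s *\<^sub>R q) c) \<le> ereal (s * inner q p)"
      using assms by (simp add: mult_left_mono)
  qed
  show "ereal (s * inner q p) \<le> (SUP c\<in>\<Phi> -` {0}. ereal (inner (s *\<^sub>R q) c))"
    using p by (intro SUP_upper2[of p]) auto
qed

lemma fenchel_conj_lower:
  assumes "\<Phi> z = ereal \<phi>"
  shows "ereal (s * inner q z - \<phi>) \<le> fenchel_conj \<Phi> (s *\<^sub>R q)"
  unfolding fenchel_conj_def using assms by (intro SUP_upper2[of z]) auto

text \<open>In other words, the conjugate at \<open>s *\<^sub>R q\<close> minus
  \<open>s * inner q p\<close> is nondecreasing in \<open>s\<close>. A competitor \<open>z\<close>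
  for \<open>s\<close> is matched for \<open>s'\<close> by \<open>z\<close> itself if
  \<open>inner q p \<le> inner q z\<close>, and otherwise by \<open>p\<close>, where
  \<open>\<Phi>\<close> vanishes.\<close>

lemma fenchel_conj_ray_mono:
  assumes "0 \<le> s" "s \<le> s'"
  shows "fenchel_conj \<Phi> (s *\<^sub>R q) \<le> fenchel_conj \<Phi> (s' *\<^sub>R q) + ereal (- ((s' - s) * inner q p))"
  unfolding fenchel_conj_def[of \<Phi> "s *\<^sub>R q"]
proof (rule SUP_least)
  fix z
  show "ereal (inner (s *\<^sub>R q) z) - \<Phi> z
      \<le> fenchel_conj \<Phi> (s' *\<^sub>R q) + ereal (- ((s' - s) * inner q p))"
  proof (cases "\<Phi> z")
    case (real \<phi>)
    have "\<phi> \<ge> 0" using nonneg[of z] real by simp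
    have "\<exists>y \<psi>. \<Phi> y = ereal \<psi> \<and> s * inner q z - \<phi> \<le> (s' * inner q y - \<psi>) - (s' - s) * inner q p"
    proof (cases "inner q p \<le> inner q z")
      case True
      then have "(s' - s) * inner q p \<le> (s' - s) * inner q z"
        using assms by (intro mult_left_mono) auto
      then show ?thesis using real by (intro exI[of _ z] exI[of _ \<phi>]) (simp add: algebra_simps)
    next
      case False
      then have "s * inner q z \<le> s * inner q p" using assms by (intro mult_left_mono) auto
      then show ?thesis using p \<open>\<phi> \<ge> 0\<close>
        by (intro exI[of _ p] exI[of _ 0]) (simp add: algebra_simps zero_ereal_def)
    qed
    then obtain y \<psi> where y: "\<Phi> y = ereal \<psi>"
      and le: "s * inner q z - \<phi> \<le> (s' * inner q y - \<psi>) - (s' - s) * inner q p" by blast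
    have "ereal (inner (s *\<^sub>R q) z) - \<Phi> z = ereal (s * inner q z - \<phi>)" using real by simp
    also have "\<dots> \<le> ereal (s' * inner q y - \<psi>) + ereal (- ((s' - s) * inner q p))" using le by simp
    also have "\<dots> \<le> fenchel_conj \<Phi> (s' *\<^sub>R q) + ereal (- ((s' - s) * inner q p))"
      by (intro add_right_mono fenchel_conj_lower y)
    finally show ?thesis .
  next
    case PInf
    then show ?thesis by simp
  next
    case MInf
    then show ?thesis using nonneg[of z] by simp
  qed
qed

text \<open>Scaling the direction by \<open>\<mu>\<close> cancels the division inside the conjugate,
  and everything but the conjugate is collected into one real number, which keeps the extended-real
  arithmetic harmless.\<close>

lemma H1_integrand_eq:
  assumes "0 < \<mu>" "0 \<le> s"
  shows "H1_integrand \<Phi> \<mu> (\<mu> *\<^sub>R q) s = ereal \<mu> * fenchel_conj \<Phi> (s *\<^sub>R q)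
      + ereal ((1/2) * (s * \<mu>)\<^sup>2 * (norm q)\<^sup>2 - s * \<mu> * inner q p)"
proof -
  have "support_fun (\<Phi> -` {0}) (s *\<^sub>R (\<mu> *\<^sub>R q)) = ereal (s * \<mu> * inner q p)"
    using support_fun_zero_set[of "s * \<mu>"] assms by simp
  moreover have "(s / \<mu>) *\<^sub>R (\<mu> *\<^sub>R q) = s *\<^sub>R q" using assms by simp
  moreover have "(norm (s *\<^sub>R (\<mu> *\<^sub>R q)))\<^sup>2 = (s * \<mu>)\<^sup>2 * (norm q)\<^sup>2"
    by (simp add: power_mult_distrib)
  moreover have "a - ereal r + ereal (1 / 2 * r') = a + ereal (1 / 2 * r' - r)" for a r r'
    by (cases a) simp_all
  ultimately show ?thesis
    unfolding H1_integrand_def by (simp only: mult.assoc)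
qed

text \<open>Testing the conjugate at a single \<open>z\<close>. With \<open>z = x t\<close> and
  \<open>q = - p\<close> the left-hand side is the upper bound that the energy estimate
  yields.\<close>

lemma H1_integrand_lower:
  assumes "0 < \<mu>" "0 \<le> s" "\<Phi> z = ereal \<phi>"
  shows "ereal (\<mu> * (s * inner q z - \<phi>) + (1/2) * (s * \<mu>)\<^sup>2 * (norm q)\<^sup>2 - s * \<mu> * inner q p)
      \<le> H1_integrand \<Phi> \<mu> (\<mu> *\<^sub>R q) s"
proof -
  have "ereal (\<mu> * (s * inner q z - \<phi>) + (1/2) * (s * \<mu>)\<^sup>2 * (norm q)\<^sup>2 - s * \<mu> * inner q p)
      = ereal \<mu> * ereal (s * inner q z - \<phi>) + ereal ((1/2) * (s * \<mu>)\<^sup>2 * (norm q)\<^sup>2 - s * \<mu> * inner q p)"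
    by simp
  also have "\<dots> \<le> H1_integrand \<Phi> \<mu> (\<mu> *\<^sub>R q) s"
    unfolding H1_integrand_eq[OF assms(1,2)] using assms
    by (intro add_right_mono ereal_mult_left_mono fenchel_conj_lower) auto
  finally show ?thesis .
qed

text \<open>The support term supplies exactly the correction \<open>(s' - s) * inner q p\<close> of
  \<open>fenchel_conj_ray_mono\<close>, and the quadratic term is itself nondecreasing.\<close>

lemma H1_integrand_mono:
  assumes "0 < \<mu>" "0 \<le> s" "s \<le> s'"
  shows "H1_integrand \<Phi> \<mu> (\<mu> *\<^sub>R q) s \<le> H1_integrand \<Phi> \<mu> (\<mu> *\<^sub>R q) s'"
proof -
  have "ereal \<mu> * fenchel_conj \<Phi> (s *\<^sub>R q)
      \<le> ereal \<mu> * (fenchel_conj \<Phi> (s' *\<^sub>R q) + ereal (- ((s' - s) * inner q p)))"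
    using assms by (intro ereal_mult_left_mono fenchel_conj_ray_mono) auto
  also have "\<dots> = ereal \<mu> * fenchel_conj \<Phi> (s' *\<^sub>R q) + ereal (- (\<mu> * (s' - s) * inner q p))"
    using assms by (cases "fenchel_conj \<Phi> (s' *\<^sub>R q)") (simp_all add: algebra_simps)
  finally have "H1_integrand \<Phi> \<mu> (\<mu> *\<^sub>R q) s
      \<le> ereal \<mu> * fenchel_conj \<Phi> (s' *\<^sub>R q) + ereal (- (\<mu> * (s' - s) * inner q p))
        + ereal ((1/2) * (s * \<mu>)\<^sup>2 * (norm q)\<^sup>2 - s * \<mu> * inner q p)"
    unfolding H1_integrand_eq[OF assms(1,2)] by (rule add_right_mono)
  also have "\<dots> = ereal \<mu> * fenchel_conj \<Phi> (s' *\<^sub>R q)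
        + ereal ((1/2) * (s * \<mu>)\<^sup>2 * (norm q)\<^sup>2 - s' * \<mu> * inner q p)"
    by (cases "ereal \<mu> * fenchel_conj \<Phi> (s' *\<^sub>R q)") (simp_all add: algebra_simps)
  also have "\<dots> \<le> H1_integrand \<Phi> \<mu> (\<mu> *\<^sub>R q) s'"
  proof -
    have "(s * \<mu>)\<^sup>2 * (norm q)\<^sup>2 \<le> (s' * \<mu>)\<^sup>2 * (norm q)\<^sup>2"
      using assms by (intro mult_right_mono power_mono) auto
    moreover have "0 \<le> s'" using assms by simp
    ultimately show ?thesis
      using assms by (simp only: H1_integrand_eq) (intro add_left_mono, simp)
  qed
  finally show ?thesis .
qed

end

lemma convex_zero_set:
  assumes "convex_fun \<Phi>" "\<And>z. 0 \<le> \<Phi> z"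
  shows "convex (\<Phi> -` {0})"
proof (rule convexI)
  fix y z :: 'a and u v :: real
  assume yz: "y \<in> \<Phi> -` {0}" "z \<in> \<Phi> -` {0}" and uv: "0 \<le> u" "0 \<le> v" "u + v = 1"
  show "u *\<^sub>R y + v *\<^sub>R z \<in> \<Phi> -` {0}"
  proof (cases "0 < v \<and> v < 1")
    case True
    have "\<Phi> ((1 - v) *\<^sub>R y + v *\<^sub>R z) \<le> ereal (1 - v) * \<Phi> y + ereal v * \<Phi> z"
      using assms(1) True unfolding convex_fun_def by blast
    moreover have "u = 1 - v" using uv(3) by simp
    ultimately have "\<Phi> (u *\<^sub>R y + v *\<^sub>R z) \<le> 0" using yz by simp
    then show ?thesis using assms(2) by (simp add: antisym)
  next
    case False
    then have "v = 0 \<and> u = 1 \<or> v = 1 \<and> u = 0" using uv by linarith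
    then show ?thesis using yz by auto
  qed
qed

lemma closed_zero_set:
  assumes "closed_fun \<Phi>" "\<And>z. 0 \<le> \<Phi> z"
  shows "closed (\<Phi> -` {0})"
proof -
  have "\<Phi> -` {0} = {z. \<Phi> z \<le> ereal 0}"
    using assms(2) by (auto simp: zero_ereal_def[symmetric] intro: antisym)
  then show ?thesis using assms(1) by (simp only: closed_fun_def)
qed

lemma tendsto_imp_weakly_tendsto: "(f \<longlongrightarrow> l) F \<Longrightarrow> weakly_tendsto f l F"
  unfolding weakly_tendsto_def by (intro allI tendsto_intros)

section \<open>Convergence of the trajectory to the projection of 0\<close>

theorem theorem3p2:
  fixes \<Phi> :: "'a::{real_inner,complete_space} \<Rightarrow> ereal"
    and lam :: real and \<epsilon> :: "real \<Rightarrow> real"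
    and x \<upsilon> :: "real \<Rightarrow> 'a"
  defines "\<mu> \<equiv> 1 / lam"
  defines "C \<equiv> argmin_set \<Phi>"
  assumes lambda_pos: "lam > 0"
    and Phi_nonneg: "\<forall>z. 0 \<le> \<Phi> z"
    and Phi_convex: "convex_fun \<Phi>"
    and Phi_closed: "closed_fun \<Phi>"
    and C_zero: "C = \<Phi> -` {0}"
    and C_ne: "C \<noteq> {}"
    and eps_nonneg: "\<forall>t\<ge>0. 0 \<le> \<epsilon> t"
    and H1: "\<forall>p\<in>normal_cone_range C.
       (\<integral>\<^sup>+ t\<in>{0..}. e2ennreal (ereal \<mu> * fenchel_conj \<Phi> ((\<epsilon> t / \<mu>) *\<^sub>R p)
            - support_fun C (\<epsilon> t *\<^sub>R p) + ereal ((1/2) * (norm (\<epsilon> t *\<^sub>R p))\<^sup>2)) \<partial>lborel) < \<infinity>"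
    and H2_noninc: "\<forall>s t. 0 \<le> s \<longrightarrow> s \<le> t \<longrightarrow> \<epsilon> t \<le> \<epsilon> s"
    and H2_C1: "\<exists>\<epsilon>'. (\<forall>t\<ge>0. (\<epsilon> has_real_derivative \<epsilon>' t) (at t within {0..}))
                 \<and> continuous_on {0..} \<epsilon>'
                 \<and> (\<exists>k\<ge>0. \<forall>t\<ge>0. - k * (\<epsilon> t)\<^sup>2 \<le> \<epsilon>' t)"
    and H2_lip: "\<exists>L. L-lipschitz_on {0..} \<epsilon>"
    and H2_lim: "(\<epsilon> \<longlongrightarrow> 0) at_top"
    and H2_int: "(\<integral>\<^sup>+ t\<in>{0..}. ennreal (\<epsilon> t) \<partial>lborel) = \<infinity>"
    and sol_ac: "\<forall>b\<ge>0. abs_cont_on 0 b x \<and> abs_cont_on 0 b \<upsilon>"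
    and sol_incl: "\<forall>t\<ge>0. \<upsilon> t \<in> subdiff \<Phi> (x t)"
    and sol_eq: "AE t in lborel. 0 \<le> t \<longrightarrow>
       (\<exists>dx dv. (x has_vector_derivative dx) (at t within {0..})
             \<and> (\<upsilon> has_vector_derivative dv) (at t within {0..})
             \<and> lam *\<^sub>R dx + dv + \<upsilon> t + \<epsilon> t *\<^sub>R x t = 0)"
  shows "weakly_tendsto (\<lambda>t. x t + \<mu> *\<^sub>R \<upsilon> t) (min_norm_elem C) at_top
     \<and> (\<Phi> 0 < \<infinity> \<longrightarrow>
          weakly_tendsto x (min_norm_elem C) at_top
        \<and> weakly_tendsto (\<lambda>t. x t + \<mu> *\<^sub>R \<upsilon> t) (min_norm_elem C) at_top
        \<and> (\<upsilon> \<longlongrightarrow> 0) at_top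
        \<and> ((\<lambda>t. x t - (x t + \<mu> *\<^sub>R \<upsilon> t)) \<longlongrightarrow> 0) at_top)"
proof -
  have "\<mu> > 0" using lambda_pos by (simp add: \<mu>_def)
  have nonneg: "0 \<le> \<Phi> z" for z using Phi_nonneg by simp
  have "closed C" "convex C"
    using closed_zero_set[OF Phi_closed nonneg] convex_zero_set[OF Phi_convex nonneg] by (simp_all add: C_zero)
  define p where "p = min_norm_elem C"
  have "p \<in> C \<and> (\<forall>c\<in>C. norm p \<le> norm c)"
    unfolding p_def min_norm_elem_def by (rule theI'[OF ex1_min_norm]) fact+
  then have pC: "p \<in> C" and p_min: "\<And>c. c \<in> C \<Longrightarrow> norm p \<le> norm c" by auto
  have p0: "\<Phi> p = 0" using pC by (simp add: C_zero)
  \<comment> \<open>Variational characterization of \<open>p\<close> as the point of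
    \<open>C\<close> closest to 0: \<open>- p\<close> is normal to \<open>C\<close> at
    \<open>p\<close>.\<close>
  have q: "inner (- p) (c - p) \<le> 0" if "\<Phi> c = 0" for c
    using any_closest_point_dot[OF \<open>convex C\<close> \<open>closed C\<close> pC, of c 0] p_min that by (simp add: C_zero)
  define y where "y = (\<lambda>t. x t + \<mu> *\<^sub>R \<upsilon> t)"
  define h where "h = (\<lambda>t. (1/2) * (norm (y t - p))\<^sup>2)"
  \<comment> \<open>\<open>e2ennreal\<close> cuts off negative values, as \<open>ennreal\<close>
    does, so real upper bounds pass to \<open>A\<close> by monotonicity whatever their sign.\<close>
  define A where "A = (\<lambda>t. e2ennreal (H1_integrand \<Phi> \<mu> (\<mu> *\<^sub>R (- p)) (\<epsilon> t)))"
  \<comment> \<open>As \<open>\<epsilon> t \<le> \<epsilon> 0\<close>, this single constant meets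
    both requirements of \<open>lyapunov_rate\<close> at all times.\<close>
  define c where "c = 1 / (1 + 2 * \<mu> * \<epsilon> 0)"
  have eps: "0 \<le> \<epsilon> t" "\<epsilon> t \<le> \<epsilon> 0" if "0 \<le> t" for t using eps_nonneg H2_noninc that by auto
  have eps_anti: "\<epsilon> t \<le> \<epsilon> s" if "0 \<le> s" "s \<le> t" for s t using H2_noninc that by simp
  have den: "1 \<le> 1 + 2 * \<mu> * \<epsilon> 0" using \<open>\<mu> > 0\<close> eps(1)[of 0] by simp
  have c: "0 < c" "c \<le> 1" using den by (auto simp: c_def)
  have c_eps: "2 * c * \<epsilon> t * \<mu> \<le> 1" if "0 \<le> t" for t
  proof -
    have "\<mu> * \<epsilon> t \<le> \<mu> * \<epsilon> 0" using eps(2)[OF that] \<open>\<mu> > 0\<close> by simp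
    then have "2 * \<mu> * \<epsilon> t \<le> 1 + 2 * \<mu> * \<epsilon> 0" by simp
    then show ?thesis using den by (simp add: c_def field_simps)
  qed
  \<comment> \<open>The subgradient inequality at \<open>x t\<close>, tested at the minimizer
    \<open>p\<close>.\<close>
  have subg: "\<exists>\<phi>. \<Phi> (x t) = ereal \<phi> \<and> 0 \<le> \<phi> \<and> \<phi> \<le> inner (\<upsilon> t) (x t - p)" if "0 \<le> t" for t
  proof -
    have "\<Phi> (x t) \<noteq> \<infinity>" and le: "\<Phi> (x t) + ereal (inner (\<upsilon> t) (p - x t)) \<le> \<Phi> p"
      using sol_incl that by (auto simp: subdiff_def)
    then obtain \<phi> where \<phi>: "\<Phi> (x t) = ereal \<phi>" using nonneg[of "x t"] by (cases "\<Phi> (x t)") auto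
    have "\<phi> + inner (\<upsilon> t) (p - x t) \<le> 0" using le by (simp add: \<phi> p0 zero_ereal_def)
    then show ?thesis using \<phi> nonneg[of "x t"] by (simp add: inner_diff_right)
  qed
  have lim_h: "(h \<longlongrightarrow> 0) at_top"
  proof (rule dissipation_tendsto_0[where A = A and g = "\<lambda>t. \<mu> * c * \<epsilon> t"])
    show "0 \<le> h t" for t by (simp add: h_def)
    show "abs_cont_on 0 b h" if "0 \<le> b" for b
    proof -
      have ac: "abs_cont_on 0 b x" "abs_cont_on 0 b \<upsilon>" using sol_ac that by auto
      have "abs_cont_on 0 b y"
      proof (rule abs_cont_on_dominated[OF ac])
        fix s t
        have "norm (y t - y s) = norm ((x t - x s) + \<mu> *\<^sub>R (\<upsilon> t - \<upsilon> s))"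
          by (simp add: y_def algebra_simps)
        also have "\<dots> \<le> norm (x t - x s) + \<mu> * norm (\<upsilon> t - \<upsilon> s)"
          using norm_triangle_ineq[of "x t - x s" "\<mu> *\<^sub>R (\<upsilon> t - \<upsilon> s)"] \<open>\<mu> > 0\<close> by simp
        also have "\<dots> \<le> (1 + \<mu>) * (norm (x t - x s) + norm (\<upsilon> t - \<upsilon> s))"
          using \<open>\<mu> > 0\<close> by (simp add: algebra_simps)
        finally show "norm (y t - y s) \<le> (1 + \<mu>) * (norm (x t - x s) + norm (\<upsilon> t - \<upsilon> s))" .
      qed
      then show ?thesis unfolding h_def by (rule abs_cont_on_half_norm_power2)
    qed
    show "AE t in lborel. 0 \<le> t \<longrightarrow> (\<exists>D. (h has_real_derivative D) (at t within {0..}) \<and>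
        ennreal (D + \<mu> * c * \<epsilon> t * h t) \<le> A t)"
      using sol_eq
    proof eventually_elim
      case (elim t)
      show ?case
      proof
        assume t: "0 \<le> t"
        then obtain dx dv where dx: "(x has_vector_derivative dx) (at t within {0..})"
          and dv: "(\<upsilon> has_vector_derivative dv) (at t within {0..})"
          and eq: "lam *\<^sub>R dx + dv + \<upsilon> t + \<epsilon> t *\<^sub>R x t = 0" using elim by blast
        \<comment> \<open>The derivative of \<open>y\<close>; since \<open>\<mu> * lam = 1\<close>,
          the equation expresses it without \<open>dx\<close> and \<open>dv\<close>.\<close>
        define d where "d = dx + \<mu> *\<^sub>R dv"
        have "d = \<mu> *\<^sub>R (lam *\<^sub>R dx + dv)" using lambda_pos by (simp add: d_def \<mu>_def algebra_simps)
        also have "lam *\<^sub>R dx + dv = - (\<upsilon> t + \<epsilon> t *\<^sub>R x t)"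
          using eq by (simp add: eq_neg_iff_add_eq_0 algebra_simps)
        finally have d: "d = - (\<mu> *\<^sub>R (\<upsilon> t + \<epsilon> t *\<^sub>R x t))"
          by (simp add: scaleR_diff_right scaleR_add_right)
        have "(y has_vector_derivative d) (at t within {0..})"
          unfolding y_def d_def
          by (intro has_vector_derivative_add dx
              bounded_linear.has_vector_derivative[OF bounded_linear_scaleR_right dv])
        then have der: "(h has_real_derivative inner d (y t - p)) (at t within {0..})"
          unfolding h_def by (rule half_norm_power2_has_real_derivative)
        obtain \<phi> where \<phi>: "\<Phi> (x t) = ereal \<phi>" "0 \<le> \<phi>" "\<phi> \<le> inner (\<upsilon> t) (x t - p)"
          using subg[OF t] by blast
        have yp: "y t - p = (x t - p) + \<mu> *\<^sub>R \<upsilon> t" by (simp add: y_def)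
        have "c * \<epsilon> t * h t + \<phi> + \<epsilon> t * inner p (x t - p) - (1/2) * \<mu> * (\<epsilon> t)\<^sup>2 * (norm p)\<^sup>2
            \<le> inner (\<upsilon> t) (y t - p) + \<epsilon> t * inner ((x t - p) + p) (y t - p)"
          unfolding h_def yp using \<phi> c \<open>\<mu> > 0\<close> eps(1)[OF t] c_eps[OF t]
          by (intro lyapunov_rate) auto
        then have "\<mu> * (c * \<epsilon> t * h t + \<phi> + \<epsilon> t * inner p (x t - p) - (1/2) * \<mu> * (\<epsilon> t)\<^sup>2 * (norm p)\<^sup>2)
            \<le> \<mu> * (inner (\<upsilon> t) (y t - p) + \<epsilon> t * inner (x t) (y t - p))"
          using \<open>\<mu> > 0\<close> by simp
        also have "\<dots> = - inner d (y t - p)" by (simp add: d inner_add_left)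
        \<comment> \<open>Expanding \<open>inner p (x t - p)\<close> leaves the squared norm of
          \<open>p\<close>, which takes the place of the support-function term for the direction
          \<open>- p\<close>.\<close>
        finally have "inner d (y t - p) + \<mu> * c * \<epsilon> t * h t
            \<le> \<mu> * (\<epsilon> t * inner (- p) (x t) - \<phi>) + (1/2) * (\<epsilon> t * \<mu>)\<^sup>2 * (norm (- p))\<^sup>2 - \<epsilon> t * \<mu> * inner (- p) p"
          by (simp add: algebra_simps power2_eq_square)
        then have "ereal (inner d (y t - p) + \<mu> * c * \<epsilon> t * h t) \<le> \<dots>" by simp
        also have "\<dots> \<le> H1_integrand \<Phi> \<mu> (\<mu> *\<^sub>R (- p)) (\<epsilon> t)"
          by (rule H1_integrand_lower[where \<Phi> = \<Phi> and p = p and q = "- p", OF nonneg p0 q \<open>\<mu> > 0\<close> eps(1)[OF t] \<phi>(1)])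
        finally have "ennreal (inner d (y t - p) + \<mu> * c * \<epsilon> t * h t) \<le> A t"
          unfolding A_def by (metis e2ennreal_ereal e2ennreal_mono)
        then show "\<exists>D. (h has_real_derivative D) (at t within {0..}) \<and>
            ennreal (D + \<mu> * c * \<epsilon> t * h t) \<le> A t" using der by blast
      qed
    qed
    show "A t \<le> A s" if "0 \<le> s" "s \<le> t" for s t
      unfolding A_def using that eps(1)[of t] eps_anti
      by (intro e2ennreal_mono H1_integrand_mono[where \<Phi> = \<Phi> and p = p and q = "- p", OF nonneg p0 q \<open>\<mu> > 0\<close>]) auto
    show "(\<integral>\<^sup>+t\<in>{0..}. A t \<partial>lborel) < \<infinity>"
    proof -
      have "inner (\<mu> *\<^sub>R (- p)) (c - p) \<le> 0" if "c \<in> C" for c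
        using q[of c] that \<open>\<mu> > 0\<close> by (simp add: C_zero mult_nonneg_nonneg)
      then have "\<mu> *\<^sub>R (- p) \<in> normal_cone_range C"
        using pC unfolding normal_cone_range_def normal_cone_def by auto
      from H1[rule_format, OF this] show ?thesis
        by (simp only: A_def H1_integrand_def C_zero)
    qed
    show "0 \<le> \<mu> * c * \<epsilon> t" if "0 \<le> t" for t using eps(1)[OF that] c \<open>\<mu> > 0\<close> by simp
    show "\<mu> * c * \<epsilon> t \<le> \<mu> * c * \<epsilon> s" if "0 \<le> s" "s \<le> t" for s t
      using eps_anti[OF that] c \<open>\<mu> > 0\<close> by simp
    have "\<not> summable (\<lambda>n. \<epsilon> (real n))"
      using eps_anti eps(1) H2_int by (rule antimono_not_summable_of_nn_integral)
    then show "\<not> summable (\<lambda>n. \<mu> * c * \<epsilon> (real n))" using c \<open>\<mu> > 0\<close> by simp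
  qed
  have "((\<lambda>t. sqrt (2 * h t)) \<longlongrightarrow> sqrt (2 * 0)) at_top"
    by (intro tendsto_intros lim_h)
  moreover have "sqrt (2 * h t) = norm (y t - p)" for t by (simp add: h_def)
  ultimately have norm_y: "((\<lambda>t. norm (y t - p)) \<longlongrightarrow> 0) at_top" by simp
  then have lim_y: "(y \<longlongrightarrow> p) at_top" by (simp add: tendsto_norm_zero_iff LIM_zero_iff)
  have lim_v: "(\<upsilon> \<longlongrightarrow> 0) at_top"
  proof (rule Lim_null_comparison)
    show "((\<lambda>t. lam * norm (y t - p)) \<longlongrightarrow> 0) at_top"
      using tendsto_mult_right_zero[OF norm_y] by simp
    show "eventually (\<lambda>t. norm (\<upsilon> t) \<le> lam * norm (y t - p)) at_top"
      using eventually_ge_at_top[of 0]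
    proof eventually_elim
      case (elim t)
      \<comment> \<open>Here \<open>y t - p\<close> splits into \<open>x t - p\<close>, whose
        product with \<open>\<upsilon> t\<close> is nonnegative by \<open>subg\<close>, and
        \<open>\<mu> *\<^sub>R \<upsilon> t\<close>.\<close>
      have "\<mu> * (norm (\<upsilon> t))\<^sup>2 \<le> inner (\<upsilon> t) (y t - p)"
        using subg[OF elim] by (auto simp: y_def inner_add_right inner_diff_right power2_norm_eq_inner)
      also have "\<dots> \<le> norm (\<upsilon> t) * norm (y t - p)" by (rule norm_cauchy_schwarz)
      finally have "norm (\<upsilon> t) * norm (\<upsilon> t) \<le> norm (\<upsilon> t) * (lam * norm (y t - p))"
        using lambda_pos by (simp add: \<mu>_def field_simps power2_eq_square)
      then show ?case
        using lambda_pos by (cases "\<upsilon> t = 0") simp_all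
    qed
  qed
  have "((\<lambda>t. y t - \<mu> *\<^sub>R \<upsilon> t) \<longlongrightarrow> p - \<mu> *\<^sub>R 0) at_top"
    by (intro tendsto_intros lim_y lim_v)
  then have lim_x: "(x \<longlongrightarrow> p) at_top" by (simp add: y_def)
  have "((\<lambda>t. x t - y t) \<longlongrightarrow> p - p) at_top"
    by (intro tendsto_intros lim_x lim_y)
  then show ?thesis
    using lim_x lim_y lim_v
    by (auto simp: p_def y_def intro: tendsto_imp_weakly_tendsto)
qed

end
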